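(* Let $n$ be a positive integer, $\Omega\subset\mathbb{C}$ a connected open set and $T\in\mathcal{B}_n(\Omega)$. Then for every $z_0\in\Omega$ there exists a complete and minimal sequence $\{f_k\}_{k=0}^\infty$ in $\mathcal{H}$ such that $T-z_0$ is the backward shift on $\{f_k\}_{k=0}^\infty$.
   Context: $\mathcal{H}$ is a separable, infinite dimensional complex Hilbert space and $\mathcal{L}(\mathcal{H})$ is the algebra of bounded linear operators on $\mathcal{H}$. $\bigvee$ denotes closed linear span. For a connected open set $\Omega\subset\mathbb{C}$ and a positive integer $n$, $\mathcal{B}_n(\Omega)$ (Cowen-Douglas operators) is the set of $T\in\mathcal{L}(\mathcal{H})$ such that: (1) $\Omega\subset\sigma(T)$; (2) $\mathrm{ran}(T-z)=\mathcal{H}$ for all $z\in\Omega$; (3) $\bigvee_{z\in\Omega}\ker(T-z)=\mathcal{H}$; (4) $\dim\ker(T-z)=n$ for all $z\in\Omega$. A sequence $\{f_k\}_{k=0}^\infty$ in $\mathcal{H}$ is complete if $\bigvee_{k\ge 0}\{f_k\}=\mathcal{H}$, and minimal if $f_m\notin\bigvee_{k\ne m}\{f_k\}$ for every $m\ge 0$. An operator $A\in\mathcal{L}(\mathcal{H})$ is the backward shift on $\{f_k\}_{k=0}^\infty$ if $Af_0=0$ and $Af_k=f_{k-1}$ for $k\ge 1$. *)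

theory Defs
  imports "HOL-Analysis.Analysis"
begin

text \<open>
  Complex inner product spaces, built on top of the real ones so that norm, topology and
  completeness are the library's. The inner product is linear in its first argument, and the
  inherited real inner product is its real part; hence \<open>norm x ^ 2 = cinner x x\<close>.
\<close>

class complex_inner = real_inner +
  fixes scaleC :: "complex \<Rightarrow> 'a \<Rightarrow> 'a" (infixr "*\<^sub>C" 75)
    and cinner :: "'a \<Rightarrow> 'a \<Rightarrow> complex"
  assumes scaleC_add_right: "a *\<^sub>C (x + y) = a *\<^sub>C x + a *\<^sub>C y"
    and scaleC_add_left: "(a + b) *\<^sub>C x = a *\<^sub>C x + b *\<^sub>C x"
    and scaleC_scaleC: "a *\<^sub>C (b *\<^sub>C x) = (a * b) *\<^sub>C x"
    and scaleC_one: "1 *\<^sub>C x = x"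
    and scaleR_scaleC: "scaleR r x = complex_of_real r *\<^sub>C x"
    and cinner_commute: "cinner x y = cnj (cinner y x)"
    and cinner_add_left: "cinner (x + y) z = cinner x z + cinner y z"
    and cinner_scaleC_left: "cinner (a *\<^sub>C x) y = a * cinner x y"
    and inner_eq_Re_cinner: "inner x y = Re (cinner x y)"

class chilbert_space = complex_inner + complete_space

instantiation complex :: chilbert_space
begin

definition scaleC_complex :: "complex \<Rightarrow> complex \<Rightarrow> complex"
  where "scaleC_complex a x = a * x"

definition cinner_complex :: "complex \<Rightarrow> complex \<Rightarrow> complex"
  where "cinner_complex x y = x * cnj y"

instance
  by standard (simp_all add: scaleC_complex_def cinner_complex_def inner_complex_def
      algebra_simps scaleR_conv_of_real)

end

global_interpretation complex_vector: vector_space "scaleC :: complex \<Rightarrow> 'a \<Rightarrow> 'a::complex_inner"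
  defines cspan = complex_vector.span
    and cdim = complex_vector.dim
    and csubspace = complex_vector.subspace
    and cdependent = complex_vector.dependent
    and cextend_basis = complex_vector.extend_basis
    and crepresentation = complex_vector.representation
  by unfold_locales (simp_all add: scaleC_add_right scaleC_add_left scaleC_scaleC scaleC_one)

definition cinfinite_dimensional :: "'a::complex_inner itself \<Rightarrow> bool"
  where "cinfinite_dimensional _ \<longleftrightarrow> \<not> (\<exists>B::'a set. finite B \<and> cspan B = UNIV)"

definition closed_cspan :: "'a::complex_inner set \<Rightarrow> 'a set"
  where "closed_cspan S = closure (cspan S)"

definition bounded_clinear :: "('a::complex_inner \<Rightarrow> 'b::complex_inner) \<Rightarrow> bool"
  where "bounded_clinear A \<longleftrightarrow> Vector_Spaces.linear scaleC scaleC A \<and> bounded_linear A"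

definition op_shift :: "('a::complex_inner \<Rightarrow> 'a) \<Rightarrow> complex \<Rightarrow> 'a \<Rightarrow> 'a"
  where "op_shift T z = (\<lambda>x. T x - z *\<^sub>C x)"

definition op_kernel :: "('a::complex_inner \<Rightarrow> 'b::complex_inner) \<Rightarrow> 'a set"
  where "op_kernel A = {x. A x = 0}"

definition op_spectrum :: "('a::complex_inner \<Rightarrow> 'a) \<Rightarrow> complex set"
  where "op_spectrum T =
    {z. \<not> (\<exists>S. bounded_clinear S \<and> S \<circ> op_shift T z = id \<and> op_shift T z \<circ> S = id)}"

text \<open>
  \<open>cdim\<close> is \<open>0\<close> on infinite-dimensional subspaces, so for positive \<open>n\<close> the last condition does
  express that the kernels are finite-dimensional of dimension \<open>n\<close>.
\<close>

definition cowen_douglas :: "nat \<Rightarrow> complex set \<Rightarrow> ('a::chilbert_space \<Rightarrow> 'a) set"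
  where "cowen_douglas n \<Omega> = {T. bounded_clinear T
    \<and> \<Omega> \<subseteq> op_spectrum T
    \<and> (\<forall>z\<in>\<Omega>. range (op_shift T z) = UNIV)
    \<and> closed_cspan (\<Union>z\<in>\<Omega>. op_kernel (op_shift T z)) = UNIV
    \<and> (\<forall>z\<in>\<Omega>. cdim (op_kernel (op_shift T z)) = n)}"

definition complete_seq :: "(nat \<Rightarrow> 'a::complex_inner) \<Rightarrow> bool"
  where "complete_seq f \<longleftrightarrow> closed_cspan (range f) = UNIV"

definition minimal_seq :: "(nat \<Rightarrow> 'a::complex_inner) \<Rightarrow> bool"
  where "minimal_seq f \<longleftrightarrow> (\<forall>m. f m \<notin> closed_cspan (f ` {k. k \<noteq> m}))"

definition backward_shift_on :: "('a::complex_inner \<Rightarrow> 'a) \<Rightarrow> (nat \<Rightarrow> 'a) \<Rightarrow> bool"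
  where "backward_shift_on A f \<longleftrightarrow> bounded_clinear A \<and> A (f 0) = 0 \<and> (\<forall>k\<ge>1. A (f k) = f (k - 1))"

end

theory Submission
  imports Defs
begin

text \<open>
  Put \<open>A = T - z\<^sub>0\<close>. By the open mapping theorem, the closure of the union of the kernels of
  \<open>(T - z) ^^ k\<close> is locally constant in \<open>z\<close>, so on the connected \<open>\<Omega>\<close> it is
  constant; it contains every \<open>ker (T - z)\<close>, hence is the whole space. Any \<open>f\<close> with \<open>A (f 0) = 0\<close>
  and \<open>A (f (k + 1)) = f k\<close> is free up to adding an element of \<open>ker A\<close> in each step. Keeping
  \<open>f k\<close> orthogonal to \<open>f 0\<close> for \<open>k > 0\<close> gives minimality, since the functional
  \<open>x \<mapsto> \<langle>A\<^sup>m x, f 0\<rangle>\<close> then separates \<open>f m\<close> from the other terms. Completeness is reached by adding,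
  at sparse times, rapidly growing multiples of vectors that span the rest of \<open>ker A\<close>.
\<close>

section \<open>Open mapping theorem with an explicit constant\<close>

instance chilbert_space \<subseteq> banach ..

text \<open>Surjectivity in quantitative form: the constant \<open>C\<close> later measures how
  large a perturbation of \<open>A\<close> may be.\<close>

definition lifts_with :: "real \<Rightarrow> ('a::real_normed_vector \<Rightarrow> 'b::real_normed_vector) \<Rightarrow> bool"
  where "lifts_with C A \<longleftrightarrow> (\<forall>y. \<exists>x. A x = y \<and> norm x \<le> C * norm y)"

text \<open>Successive approximation: lift \<open>y\<close> up to half its norm, then lift the
  remainder, and so on. The corrections are dominated by a geometric series with sum
  \<open>2 * C * norm y\<close>, so they converge in the complete domain. The open mapping theorem
  and the stability of \<open>lifts_with\<close> under shifts both rest on this.\<close>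

lemma lifts_with_of_approximate:
  fixes A :: "'a::banach \<Rightarrow> 'b::real_normed_vector"
  assumes A: "bounded_linear A"
    and approx: "\<And>y. \<exists>x. norm x \<le> C * norm y \<and> norm (y - A x) \<le> norm y / 2"
  shows "lifts_with (2 * C) A"
  unfolding lifts_with_def
proof
  fix y
  interpret bounded_linear A by (fact A)
  obtain g where g: "\<And>y. norm (g y) \<le> C * norm y" "\<And>y. norm (y - A (g y)) \<le> norm y / 2"
    using approx by metis
  define r where "r k = ((\<lambda>y. y - A (g y)) ^^ k) y" for k
  have r_Suc: "r (Suc k) = r k - A (g (r k))" for k by (simp add: r_def)
  have r_le: "norm (r k) \<le> norm y * (1/2) ^ k" for k
  proof (induction k)
    case 0
    show ?case by (simp add: r_def)
  next
    case (Suc k)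
    then show ?case using g(2)[of "r k"] by (simp add: r_Suc)
  qed
  \<comment> \<open>No sign of \<open>C\<close> is assumed; it follows from the bound on the lift of
    \<open>y\<close> unless \<open>y = 0\<close>.\<close>
  have C0: "C \<ge> 0 \<or> y = 0"
    using order_trans[OF norm_ge_zero g(1)[of y]] by (auto simp: zero_le_mult_iff)
  have gr: "norm (g (r k)) \<le> C * norm y * (1/2) ^ k" for k
  proof (cases "y = 0")
    case True
    then have "r k = 0" using r_le[of k] by simp
    then show ?thesis using g(1)[of "r k"] True by simp
  next
    case False
    then have "C * norm (r k) \<le> C * (norm y * (1/2) ^ k)" using C0 r_le by (intro mult_left_mono) auto
    then show ?thesis using g(1)[of "r k"] by (simp add: mult.assoc)
  qed
  have geo: "(\<lambda>k. C * norm y * (1/2::real) ^ k) sums (C * norm y * 2)"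
    using sums_mult[OF geometric_sums[of "1/2::real"], of "C * norm y"] by simp
  have nsum: "summable (\<lambda>k. norm (g (r k)))"
    by (rule summable_comparison_test'[OF sums_summable[OF geo], of 0]) (use gr in auto)
  then have sm: "summable (\<lambda>k. g (r k))" by (rule summable_norm_cancel)
  have "norm (\<Sum>k. g (r k)) \<le> (\<Sum>k. norm (g (r k)))" by (rule summable_norm[OF nsum])
  also have "\<dots> \<le> (\<Sum>k. C * norm y * (1/2) ^ k)"
    by (rule suminf_le[OF gr nsum sums_summable[OF geo]])
  finally have bound: "norm (\<Sum>k. g (r k)) \<le> 2 * C * norm y" using sums_unique[OF geo] by simp
  have "r \<longlonglongrightarrow> 0"
  proof (rule Lim_null_comparison)
    show "\<forall>\<^sub>F k in sequentially. norm (r k) \<le> norm y * (1/2) ^ k" using r_le by simp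
    show "(\<lambda>k. norm y * (1/2::real) ^ k) \<longlonglongrightarrow> 0"
      by (rule tendsto_mult_right_zero) (rule LIMSEQ_realpow_zero; simp)
  qed
  moreover have "r 0 = y" by (simp add: r_def)
  ultimately have "(\<lambda>k. r k - r (Suc k)) sums (y - 0)"
    by (metis telescope_sums')
  then have "(\<lambda>k. A (g (r k))) sums y" by (simp add: r_Suc)
  moreover have "(\<lambda>k. A (g (r k))) sums A (\<Sum>k. g (r k))" by (rule sums[OF summable_sums[OF sm]])
  ultimately have "A (\<Sum>k. g (r k)) = y" by (metis sums_unique2)
  with bound show "\<exists>x. A x = y \<and> norm x \<le> 2 * C * norm y" by blast
qed

text \<open>This is the open mapping theorem. By Baire, the image of some ball is dense in a ball
  around some \<open>y0\<close>; subtracting approximations of \<open>y0 + y\<close> and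
  \<open>y0\<close> moves the centre to 0, and rescaling yields approximate lifts of every
  vector.\<close>

lemma surj_lifts_with:
  fixes A :: "'a::banach \<Rightarrow> 'b::banach"
  assumes A: "bounded_linear A" and "surj A"
  obtains C where "lifts_with C A"
proof -
  interpret bounded_linear A by (fact A)
  let ?S = "\<lambda>N::nat. closure (A ` cball 0 (real N))"
  have "\<exists>N. interior (?S N) \<noteq> {}"
  proof (rule ccontr)
    assume "\<not> ?thesis"
    then have "(euclidean :: 'b topology) interior_of \<Union>(range ?S) = {}"
      by (intro Baire_category_alt) (auto simp: completely_metrizable_space_euclidean)
    moreover have "y \<in> \<Union>(range ?S)" for y
    proof -
      obtain x where x: "y = A x" using \<open>surj A\<close> by (auto simp: surj_def)
      obtain N :: nat where "norm x \<le> real N" using real_arch_simple by blast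
      then have "y \<in> ?S N" using x by (intro closure_subset[THEN subsetD]) auto
      then show ?thesis by blast
    qed
    ultimately show False by (metis UNIV_I UNIV_eq_I interior_UNIV interior_of_topspace topspace_euclidean empty_iff)
  qed
  then obtain N y0 where "y0 \<in> interior (?S N)" by blast
  then obtain e where e: "e > 0" "ball y0 e \<subseteq> ?S N" by (auto simp: mem_interior)
  have y0S: "y0 \<in> ?S N" using e by auto
  have approx_ball: "\<exists>x. norm x \<le> 2 * real N \<and> norm (y - A x) < e / 4" if "norm y < e" for y
  proof -
    have "y0 + y \<in> ?S N" using e that by (auto simp: dist_norm)
    then obtain x1 where x1: "norm x1 \<le> real N" "dist (A x1) (y0 + y) < e / 8"
      using e by (force simp: closure_approachable elim!: allE[of _ "e/8"])
    obtain x2 where x2: "norm x2 \<le> real N" "dist (A x2) y0 < e / 8"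
      using y0S e by (force simp: closure_approachable elim!: allE[of _ "e/8"])
    have "norm (y - A (x1 - x2)) = norm ((A x2 - y0) - (A x1 - (y0 + y)))"
      by (simp add: diff algebra_simps)
    also have "\<dots> < e / 4" using norm_triangle_ineq4[of "A x2 - y0" "A x1 - (y0 + y)"] x1 x2
      by (simp add: dist_norm)
    finally show ?thesis using x1 x2 norm_triangle_ineq4[of x1 x2] by (intro exI[of _ "x1 - x2"]) auto
  qed
  have "\<exists>x. norm x \<le> (4 * real N / e) * norm y \<and> norm (y - A x) \<le> norm y / 2" for y
  proof (cases "y = 0")
    case True
    then show ?thesis by (intro exI[of _ 0]) (auto simp: zero)
  next
    case False
    \<comment> \<open>This factor brings \<open>y /\<^sub>R t\<close> to norm \<open>e / 2\<close>,
      inside the ball, and turns the error \<open>e / 4\<close> into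
      \<open>norm y / 2\<close>.\<close>
    define t where "t = 2 * norm y / e"
    have t: "t > 0" using False e by (simp add: t_def)
    have "norm (y /\<^sub>R t) = e / 2" using False e by (simp add: t_def field_simps)
    then obtain x where x: "norm x \<le> 2 * real N" "norm (y /\<^sub>R t - A x) < e / 4"
      using approx_ball[of "y /\<^sub>R t"] e by auto
    have "y - A (t *\<^sub>R x) = t *\<^sub>R (y /\<^sub>R t - A x)" using t by (simp add: scaleR algebra_simps)
    then have "norm (y - A (t *\<^sub>R x)) = t * norm (y /\<^sub>R t - A x)" using t by simp
    also have "\<dots> \<le> t * (e / 4)" using t x by (intro mult_left_mono) auto
    finally have 1: "norm (y - A (t *\<^sub>R x)) \<le> norm y / 2" using e by (simp add: t_def)
    have "norm (t *\<^sub>R x) \<le> t * (2 * real N)" using t x by (simp add: mult_left_mono)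
    also have "\<dots> = (4 * real N / e) * norm y" by (simp add: t_def)
    finally show ?thesis using 1 by blast
  qed
  from lifts_with_of_approximate[OF A this] show thesis by (rule that)
qed

section \<open>Complex scalars, bounded operators and closed spans\<close>

text \<open>The diagonal of \<open>cinner\<close> is real by conjugate symmetry, so the factor
  \<open>a * cnj a\<close> comes out of its real part.\<close>

lemma norm_scaleC: "norm (a *\<^sub>C x) = cmod a * norm (x :: 'a::complex_inner)"
proof -
  have norm2: "(norm x)\<^sup>2 = Re (cinner x x)" for x :: 'a
    by (simp add: power2_norm_eq_inner inner_eq_Re_cinner)
  have "Im (cinner x x) = 0" using cinner_commute[of x x] by (metis complex_cnj_cancel_iff cnj.simps(2) neg_equal_zero)
  moreover have "cinner (a *\<^sub>C x) (a *\<^sub>C x) = a * (cnj a * cinner x x)"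
    by (metis cinner_commute cinner_scaleC_left complex_cnj_mult)
  ultimately have "Re (cinner (a *\<^sub>C x) (a *\<^sub>C x)) = (cmod a)\<^sup>2 * Re (cinner x x)"
    by (simp add: cmod_power2 algebra_simps power2_eq_square[of "Re a"] power2_eq_square[of "Im a"])
  then have "(norm (a *\<^sub>C x))\<^sup>2 = (cmod a * norm x)\<^sup>2"
    by (simp add: norm2 power_mult_distrib)
  then show ?thesis by (simp add: power2_eq_iff_nonneg)
qed

lemma bounded_linear_scaleC: "bounded_linear (\<lambda>x :: 'a::complex_inner. a *\<^sub>C x)"
  by (rule bounded_linear_intro[of _ "cmod a"])
    (auto simp: scaleC_add_right scaleR_scaleC scaleC_scaleC norm_scaleC mult.commute)

lemma bounded_linear_cinner_left: "bounded_linear (\<lambda>x :: 'a::complex_inner. cinner x e)"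
proof (rule bounded_linear_intro[of _ "norm e"])
  show "norm (cinner x e) \<le> norm x * norm e" for x :: 'a
  proof -
    \<comment> \<open>A unimodular \<open>u\<close> rotates \<open>cinner x e\<close> onto the
      nonnegative real axis, where the real Cauchy-Schwarz inequality applies to
      \<open>u *\<^sub>C x\<close>.\<close>
    obtain u where u: "cmod u = 1" "u * cinner x e = complex_of_real (cmod (cinner x e))"
    proof (cases "cinner x e = 0")
      case True
      then show thesis using that[of 1] by simp
    next
      case False
      then show thesis
        by (intro that[of "cnj (cinner x e) / cmod (cinner x e)"])
           (auto simp: norm_divide field_simps complex_norm_square[symmetric] power2_eq_square mult.commute)
    qed
    have "cmod (cinner x e) = inner (u *\<^sub>C x) e"
      by (simp add: inner_eq_Re_cinner cinner_scaleC_left u)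
    also have "\<dots> \<le> norm (u *\<^sub>C x) * norm e" by (rule norm_cauchy_schwarz)
    finally show ?thesis by (simp add: norm_scaleC u)
  qed
qed (auto simp: cinner_add_left scaleR_scaleC cinner_scaleC_left scaleC_complex_def)

lemma bounded_clinear_iff:
  "bounded_clinear A \<longleftrightarrow> bounded_linear A \<and> (\<forall>c x. A (c *\<^sub>C x) = c *\<^sub>C A x)"
  unfolding bounded_clinear_def Vector_Spaces.linear_iff
  using linear_add[OF bounded_linear.linear] by (auto simp: complex_vector.vector_space_axioms)

lemma bounded_clinear_op_shift:
  assumes "bounded_clinear T"
  shows "bounded_clinear (op_shift T z)"
  using assms unfolding bounded_clinear_iff op_shift_def
  by (auto intro!: bounded_linear_sub bounded_linear_scaleC
      simp: complex_vector.scale_right_diff_distrib scaleC_scaleC mult.commute)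

lemma csubspace_closure:
  fixes S :: "'a::complex_inner set"
  assumes S: "csubspace S"
  shows "csubspace (closure S)"
proof (rule complex_vector.subspaceI)
  show "0 \<in> closure S" using complex_vector.subspace_0[OF S] closure_subset by blast
next
  fix x y assume "x \<in> closure S" "y \<in> closure S"
  then obtain f g where "\<And>n. f n \<in> S" "f \<longlonglongrightarrow> x" "\<And>n. g n \<in> S" "g \<longlonglongrightarrow> y"
    unfolding closure_sequential by blast
  then show "x + y \<in> closure S"
    using tendsto_add complex_vector.subspace_add[OF S] unfolding closure_sequential
    by (intro exI[of _ "\<lambda>n. f n + g n"]) auto
next
  fix c x assume "x \<in> closure S"
  then obtain f where "\<And>n. f n \<in> S" "f \<longlonglongrightarrow> x"
    unfolding closure_sequential by blast
  then show "c *\<^sub>C x \<in> closure S"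
    using bounded_linear.tendsto[OF bounded_linear_scaleC] complex_vector.subspace_scale[OF S]
    unfolding closure_sequential
    by (intro exI[of _ "\<lambda>n. c *\<^sub>C f n"]) auto
qed

lemma csubspace_closed_cspan: "csubspace (closed_cspan S)"
  unfolding closed_cspan_def by (intro csubspace_closure complex_vector.subspace_span)

lemma closed_cspan_minimal:
  assumes "S \<subseteq> V" "csubspace V" "closed V"
  shows "closed_cspan S \<subseteq> V"
  unfolding closed_cspan_def by (intro closure_minimal complex_vector.span_minimal assms)

lemma closed_cspan_base: "x \<in> S \<Longrightarrow> x \<in> closed_cspan S"
  unfolding closed_cspan_def using closure_subset complex_vector.span_base by blast

section \<open>Generalized kernels and their stability under small shifts\<close>

definition root_space :: "('a::complex_inner \<Rightarrow> 'a) \<Rightarrow> 'a set"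
  where "root_space A = {x. \<exists>k. (A ^^ k) x = 0}"

lemma bounded_clinear_funpow:
  fixes A :: "'a::complex_inner \<Rightarrow> 'a"
  assumes "bounded_clinear A"
  shows "bounded_clinear (A ^^ k)"
proof (induction k)
  case 0
  then show ?case by (simp add: bounded_clinear_iff id_def)
next
  case (Suc k)
  then show ?case using assms unfolding bounded_clinear_iff
    by (auto simp: o_def intro: bounded_linear_compose)
qed

lemma funpow_eq_0_mono:
  fixes A :: "'a::zero \<Rightarrow> 'a"
  assumes "A 0 = 0" "(A ^^ k) x = 0" "k \<le> m"
  shows "(A ^^ m) x = 0"
proof -
  have "(A ^^ j) 0 = 0" for j by (induction j) (auto simp: assms)
  then show ?thesis using assms by (metis funpow_add comp_apply le_add_diff_inverse2)
qed

lemma csubspace_root_space: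
  assumes A: "bounded_clinear A"
  shows "csubspace (root_space A)"
proof (rule complex_vector.subspaceI)
  have lin: "linear (A ^^ k)" and C: "(A ^^ k) (c *\<^sub>C x) = c *\<^sub>C (A ^^ k) x" for k c x
    using bounded_clinear_funpow[OF A] by (auto simp: bounded_clinear_iff bounded_linear.linear)
  have A0: "A 0 = 0" using linear_0[OF lin[of 1]] by simp
  show "0 \<in> root_space A" by (auto simp: root_space_def intro: exI[of _ 0])
  show "c *\<^sub>C x \<in> root_space A" if "x \<in> root_space A" for c x
    using that by (auto simp: root_space_def C)
  fix x y assume "x \<in> root_space A" "y \<in> root_space A"
  then obtain k l where "(A ^^ k) x = 0" "(A ^^ l) y = 0" by (auto simp: root_space_def)
  then have "(A ^^ (max k l)) x = 0" "(A ^^ (max k l)) y = 0"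
    using funpow_eq_0_mono[of A, OF A0] by (metis max.cobounded1, metis max.cobounded2)
  then show "x + y \<in> root_space A"
    by (auto simp: root_space_def linear_add[OF lin] intro!: exI[of _ "max k l"])
qed

lemma lifts_with_nonneg:
  fixes A :: "'a::real_normed_vector \<Rightarrow> 'b::real_normed_vector"
    and y :: 'b
  assumes "lifts_with C A" "y \<noteq> 0"
  shows "C \<ge> 0"
proof -
  obtain x :: 'a where "norm x \<le> C * norm y" using assms unfolding lifts_with_def by metis
  then have "0 \<le> C * norm y" using norm_ge_zero order_trans by blast
  then show ?thesis using assms by (simp add: zero_le_mult_iff)
qed

text \<open>The operator induced by \<open>A\<close> on the quotient by the closure of its root space is bounded below
  by \<open>1 / C\<close>, hence so is its perturbation by \<open>w\<close>.\<close>

lemma mem_closure_root_space: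
  fixes A :: "'a::complex_inner \<Rightarrow> 'a"
  assumes A: "bounded_clinear A" and C: "lifts_with C A" and w: "cmod w * C < 1"
    and v: "op_shift A w v \<in> closure (root_space A)"
  shows "v \<in> closure (root_space A)"
proof (cases "v = 0")
  case True
  then show ?thesis using complex_vector.subspace_0[OF csubspace_root_space[OF A]] closure_subset by blast
next
  case False
  interpret A: bounded_linear A using A by (simp add: bounded_clinear_iff)
  let ?M = "root_space A"
  note sub = csubspace_root_space[OF A]
  have C0: "C \<ge> 0" using lifts_with_nonneg[OF C False] .
  have ne: "?M \<noteq> {}" using complex_vector.subspace_0[OF sub] by blast
  \<comment> \<open>Since \<open>A (v - r) = m\<close>, the vector \<open>v - r\<close> is again in
    the root space, and its distance from \<open>v\<close> is \<open>norm r\<close>.\<close>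
  have 1: "infdist v ?M \<le> C * norm (A v - m)" if m: "m \<in> ?M" for m
  proof -
    obtain r where r: "A r = A v - m" "norm r \<le> C * norm (A v - m)"
      using C by (auto simp: lifts_with_def)
    obtain k where "(A ^^ k) m = 0" using m by (auto simp: root_space_def)
    then have "(A ^^ Suc k) (v - r) = 0" by (simp add: funpow_Suc_right A.diff r del: funpow.simps)
    then have "v - r \<in> ?M" unfolding root_space_def by blast
    then show ?thesis using r infdist_le[of "v - r" ?M v] by (simp add: dist_norm)
  qed
  \<comment> \<open>For \<open>m\<close> close to \<open>op_shift A w v\<close>, the root vector
    \<open>w *\<^sub>C b + m\<close> is within about \<open>cmod w * dist v b\<close> of
    \<open>A v\<close>. Dividing \<open>e\<close> by \<open>C + 1\<close> rather than
    \<open>C\<close> admits \<open>C = 0\<close>.\<close>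
  have 2: "infdist v ?M \<le> C * cmod w * dist v b" if "b \<in> ?M" for b
  proof (rule field_le_epsilon)
    fix e :: real assume "e > 0"
    then have "e / (C + 1) > 0" using C0 by simp
    then obtain m where m: "m \<in> ?M" "dist m (op_shift A w v) < e / (C + 1)"
      using v unfolding closure_approachable by blast
    let ?m = "w *\<^sub>C b + m"
    have "?m \<in> ?M" using that m sub by (simp add: complex_vector.subspace_add complex_vector.subspace_scale)
    then have "infdist v ?M \<le> C * norm (A v - ?m)" by (rule 1)
    also have "A v - ?m = w *\<^sub>C (v - b) - (m - op_shift A w v)"
      by (simp add: op_shift_def complex_vector.scale_right_diff_distrib)
    also have "norm \<dots> \<le> cmod w * dist v b + e / (C + 1)"
      using norm_triangle_ineq4[of "w *\<^sub>C (v - b)" "m - op_shift A w v"] m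
      by (simp add: norm_scaleC dist_norm)
    finally have "infdist v ?M \<le> C * (cmod w * dist v b + e / (C + 1))"
      using C0 by (simp add: mult_left_mono)
    moreover have "C * (e / (C + 1)) \<le> e" using C0 \<open>e > 0\<close> by (simp add: field_simps)
    ultimately show "infdist v ?M \<le> C * cmod w * dist v b + e" by (simp add: algebra_simps)
  qed
  \<comment> \<open>Taking the infimum over \<open>b\<close> bounds the distance by itself times a
    factor below 1, which forces it to be 0.\<close>
  have "infdist v ?M \<le> (C * cmod w) * infdist v ?M"
  proof (cases "C * cmod w = 0")
    case True
    then show ?thesis using 2 ne by force
  next
    case False
    then have pos: "C * cmod w > 0" using C0 by (simp add: zero_less_mult_iff less_le)
    have "infdist v ?M / (C * cmod w) \<le> infdist v ?M"
      by (subst (2) infdist_notempty[OF ne], rule cINF_greatest[OF ne])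
        (use 2 pos in \<open>simp add: field_simps\<close>)
    then show ?thesis using pos by (simp add: field_simps)
  qed
  then have "(1 - C * cmod w) * infdist v ?M \<le> 0" by (simp add: algebra_simps)
  then have "infdist v ?M = 0" using w infdist_nonneg[of v ?M]
    by (simp add: mult_le_0_iff mult.commute)
  then show ?thesis using in_closure_iff_infdist_zero[OF ne] by blast
qed

text \<open>Membership in the closure is pulled back from 0 through one factor
  \<open>op_shift A w\<close> at a time.\<close>

lemma root_space_shift_subset:
  fixes A :: "'a::complex_inner \<Rightarrow> 'a"
  assumes A: "bounded_clinear A" and C: "lifts_with C A" and w: "cmod w * C < 1"
  shows "closure (root_space (op_shift A w)) \<subseteq> closure (root_space A)"
proof -
  have 0: "0 \<in> closure (root_space A)"
    using complex_vector.subspace_0[OF csubspace_root_space[OF A]] closure_subset by blast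
  have "v \<in> closure (root_space A)" if "(op_shift A w ^^ k) v = 0" for k v
    using that
  proof (induction k arbitrary: v)
    case 0
    then show ?case using \<open>0 \<in> closure (root_space A)\<close> by simp
  next
    case (Suc k)
    then have "(op_shift A w ^^ k) (op_shift A w v) = 0"
      by (simp add: funpow_Suc_right del: funpow.simps)
    then show ?case using Suc.IH mem_closure_root_space[OF A C w] by blast
  qed
  then have "root_space (op_shift A w) \<subseteq> closure (root_space A)" by (auto simp: root_space_def)
  then show ?thesis by (simp add: closure_minimal)
qed

text \<open>A lift of \<open>y\<close> under \<open>A\<close> misses \<open>y\<close> under
  \<open>op_shift A w\<close> only by \<open>w *\<^sub>C x\<close>, which has at most half the norm
  of \<open>y\<close>.\<close>

lemma lifts_with_op_shift:
  fixes A :: "'a::chilbert_space \<Rightarrow> 'a"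
  assumes A: "bounded_clinear A" and C: "lifts_with C A" and w: "cmod w * C \<le> 1 / 2"
  shows "lifts_with (2 * C) (op_shift A w)"
proof (rule lifts_with_of_approximate)
  show "bounded_linear (op_shift A w)"
    using bounded_clinear_op_shift[OF A] by (simp add: bounded_clinear_iff)
  fix y
  obtain x where x: "A x = y" "norm x \<le> C * norm y" using C by (auto simp: lifts_with_def)
  have "norm (y - op_shift A w x) = cmod w * norm x" by (simp add: op_shift_def x norm_scaleC)
  also have "\<dots> \<le> cmod w * (C * norm y)" using x by (intro mult_left_mono) auto
  also have "\<dots> \<le> norm y / 2" using mult_right_mono[OF w norm_ge_zero[of y]] by (simp add: mult.assoc)
  finally show "\<exists>x. norm x \<le> C * norm y \<and> norm (y - op_shift A w x) \<le> norm y / 2" using x by blast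
qed

lemma op_shift_op_shift: "op_shift (op_shift T z) w = op_shift T (z + w)"
  by (simp add: op_shift_def fun_eq_iff complex_vector.scale_left_distrib)

text \<open>Perturbing from \<open>z\<close> to \<open>w\<close> gives one inclusion. The other
  perturbs back from \<open>w\<close>, which needs a lifting constant at \<open>w\<close> that is
  uniform in \<open>w\<close>.\<close>

lemma closure_root_space_eq_near:
  fixes T :: "'a::chilbert_space \<Rightarrow> 'a"
  assumes T: "bounded_clinear T" and surj: "surj (op_shift T z)"
  obtains d where "d > 0" and
    "\<And>w. dist w z < d \<Longrightarrow> closure (root_space (op_shift T w)) = closure (root_space (op_shift T z))"
proof -
  note A = bounded_clinear_op_shift[OF T]
  obtain C where "lifts_with C (op_shift T z)"
    using surj_lifts_with[OF _ surj] A by (auto simp: bounded_clinear_iff)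
  then have C: "lifts_with (\<bar>C\<bar> + 1) (op_shift T z)"
    unfolding lifts_with_def by (meson order_trans mult_right_mono norm_ge_zero abs_ge_self add_increasing2 zero_le_one)
  \<comment> \<open>Within this radius the lifting constant at most doubles, and even the doubled
    constant times \<open>cmod (w - z)\<close> stays below 1, as the way back requires.\<close>
  define d where "d = 1 / (4 * (\<bar>C\<bar> + 1))"
  have "d > 0" by (simp add: d_def)
  moreover have "closure (root_space (op_shift T w)) = closure (root_space (op_shift T z))"
    if "dist w z < d" for w
  proof
    have small: "cmod (w - z) * (\<bar>C\<bar> + 1) < 1 / 4"
      using that by (simp add: d_def dist_norm field_simps)
    have eq: "op_shift T w = op_shift (op_shift T z) (w - z)"
      "op_shift T z = op_shift (op_shift T w) (z - w)" by (simp_all add: op_shift_op_shift)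
    show "closure (root_space (op_shift T w)) \<subseteq> closure (root_space (op_shift T z))"
      unfolding eq(1) by (rule root_space_shift_subset[OF A C]) (use small in auto)
    have "lifts_with (2 * (\<bar>C\<bar> + 1)) (op_shift T w)"
      unfolding eq(1) by (rule lifts_with_op_shift[OF A C]) (use small in auto)
    then have "closure (root_space (op_shift (op_shift T w) (z - w))) \<subseteq> closure (root_space (op_shift T w))"
      by (rule root_space_shift_subset[OF A]) (use small in \<open>simp add: norm_minus_commute algebra_simps\<close>)
    then show "closure (root_space (op_shift T z)) \<subseteq> closure (root_space (op_shift T w))"
      unfolding eq(2)[symmetric] .
  qed
  ultimately show thesis by (rule that)
qed

text \<open>Connectedness turns local constancy into constancy on \<open>\<Omega>\<close>, so a
  single closed subspace contains the eigenvectors for all points of \<open>\<Omega>\<close>, whose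
  span is dense.\<close>

lemma closure_root_space_eq_UNIV:
  fixes T :: "'a::chilbert_space \<Rightarrow> 'a"
  assumes T: "bounded_clinear T" and "open \<Omega>" "connected \<Omega>"
    and surj: "\<And>z. z \<in> \<Omega> \<Longrightarrow> surj (op_shift T z)"
    and dense: "closed_cspan (\<Union>z\<in>\<Omega>. op_kernel (op_shift T z)) = UNIV"
    and z: "z \<in> \<Omega>"
  shows "closure (root_space (op_shift T z)) = UNIV"
proof -
  let ?K = "\<lambda>z. closure (root_space (op_shift T z))"
  have const: "?K z = ?K w" if w: "w \<in> \<Omega>" for w
  proof (rule connected_equivalence_relation[OF \<open>connected \<Omega>\<close> z w, where R = "\<lambda>z w. ?K z = ?K w"])
    fix a assume a: "a \<in> \<Omega>"
    obtain d where d: "d > 0" "\<And>w. dist w a < d \<Longrightarrow> ?K w = ?K a"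
      using closure_root_space_eq_near[OF T surj[OF a]] by metis
    show "\<exists>U. openin (top_of_set \<Omega>) U \<and> a \<in> U \<and> (\<forall>x\<in>U. ?K a = ?K x)"
    proof (intro exI conjI ballI)
      show "openin (top_of_set \<Omega>) (\<Omega> \<inter> ball a d)" by (simp add: openin_open_Int)
      show "a \<in> \<Omega> \<inter> ball a d" using a d(1) by simp
      show "?K a = ?K x" if "x \<in> \<Omega> \<inter> ball a d" for x
        using that by (intro d(2)[symmetric]) (simp add: dist_commute)
    qed
  qed auto
  have "op_kernel (op_shift T w) \<subseteq> ?K z" if "w \<in> \<Omega>" for w
  proof -
    have "op_kernel (op_shift T w) \<subseteq> root_space (op_shift T w)"
      by (auto simp: op_kernel_def root_space_def intro: exI[of _ 1])
    then show ?thesis using const[OF that] closure_subset by fast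
  qed
  then have "closed_cspan (\<Union>z\<in>\<Omega>. op_kernel (op_shift T z)) \<subseteq> ?K z"
    using T by (intro closed_cspan_minimal csubspace_closure csubspace_root_space bounded_clinear_op_shift) auto
  then show ?thesis using dense by auto
qed

section \<open>Minimality of sequences under a backward shift\<close>

text \<open>The bounded functional taking \<open>x\<close> to \<open>cinner ((A ^^ m) x) e\<close>
  vanishes at \<open>f k\<close> for \<open>k < m\<close>, where \<open>A ^^ m\<close> kills
  \<open>f k\<close>, and for \<open>k > m\<close>, where it gives \<open>f (k - m)\<close>; at
  \<open>f m\<close> its value is \<open>cinner (f 0) e\<close>.\<close>

lemma minimal_seq_backward_shift:
  assumes A: "backward_shift_on A f"
    and e0: "cinner (f 0) e \<noteq> 0" and e: "\<And>k. k > 0 \<Longrightarrow> cinner (f k) e = 0"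
  shows "minimal_seq f"
  unfolding minimal_seq_def
proof (rule allI, rule notI)
  fix m assume m: "f m \<in> closed_cspan (f ` {k. k \<noteq> m})"
  have lin: "bounded_clinear A" and A0: "A (f 0) = 0" and ASuc: "A (f (Suc k)) = f k" for k
    using A by (auto simp: backward_shift_on_def)
  have pow: "(A ^^ j) (f (j + k)) = f k" for j k
    by (induction j) (auto simp: ASuc funpow_Suc_right simp del: funpow.simps)
  let ?V = "{x. cinner ((A ^^ m) x) e = 0}"
  have bl: "bounded_linear (\<lambda>x. cinner ((A ^^ m) x) e)"
    using bounded_linear_compose[OF bounded_linear_cinner_left] bounded_clinear_funpow[OF lin]
    by (auto simp: bounded_clinear_iff)
  have "closed_cspan (f ` {k. k \<noteq> m}) \<subseteq> ?V"
  proof (rule closed_cspan_minimal)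
    show "closed ?V" by (intro closed_Collect_eq continuous_intros linear_continuous_on bl)
    have "bounded_clinear (A ^^ m)" by (rule bounded_clinear_funpow[OF lin])
    then show "csubspace ?V"
      by (intro complex_vector.subspaceI)
        (auto simp: bounded_clinear_iff linear_0 linear_add bounded_linear.linear cinner_add_left cinner_scaleC_left
          linear_0[OF bounded_linear.linear[OF bounded_linear_cinner_left]])
    show "f ` {k. k \<noteq> m} \<subseteq> ?V"
    proof clarify
      fix k assume "k \<noteq> m"
      then consider "k < m" | j where "k = m + j" "j > 0" by (metis less_imp_add_positive nat_neq_iff)
      then show "cinner ((A ^^ m) (f k)) e = 0"
      proof cases
        case 1
        have "(A ^^ Suc k) (f k) = 0" using pow[of k 0] A0 by simp
        moreover have "A 0 = 0" using lin by (simp add: bounded_clinear_iff linear_0 bounded_linear.linear)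
        ultimately have "(A ^^ m) (f k) = 0" using 1 funpow_eq_0_mono[of A "Suc k"] by simp
        then show ?thesis by (simp add: linear_0[OF bounded_linear.linear[OF bounded_linear_cinner_left]])
      next
        case 2
        then show ?thesis by (simp add: pow e)
      qed
    qed
  qed
  then have "cinner ((A ^^ m) (f m)) e = 0" using m by blast
  then show False using pow[of m 0] e0 by simp
qed

section \<open>Construction of a complete and minimal sequence\<close>

text \<open>The elements of \<open>B\<close> are placed at the perfect squares, whose gaps grow
  without bound, and each element is repeated infinitely often.\<close>

lemma sparse_enumeration:
  fixes B :: "'a::zero set"
  assumes "countable B"
  obtains s :: "nat \<Rightarrow> 'a" where "range s \<subseteq> insert 0 B"
    and "\<And>x m N. x \<in> B \<Longrightarrow> \<exists>k\<ge>N. s k = x \<and> (\<forall>i\<in>{1..m}. s (k + i) = 0)"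
proof (cases "B = {}")
  case True
  then show thesis by (intro that[of "\<lambda>_. 0"]) auto
next
  case False
  \<comment> \<open>The second component of the decoded pair is ignored, so every element of
    \<open>B\<close> recurs at arbitrarily late indices.\<close>
  define u where "u j = from_nat_into B (fst (prod_decode j))" for j
  define s where "s k = (if \<exists>j. k = j\<^sup>2 then u (floor_sqrt k) else 0)" for k
  show thesis
  proof (rule that)
    show "range s \<subseteq> insert 0 B" using from_nat_into[OF False] by (auto simp: s_def u_def)
    fix x m and N :: nat assume "x \<in> B"
    then obtain i where i: "from_nat_into B i = x" using assms from_nat_into_to_nat_on by metis
    \<comment> \<open>\<open>prod_encode\<close> is at least its second argument, hence
      \<open>j\<close> is at least \<open>N\<close> and \<open>m\<close>.\<close>
    define j where "j = prod_encode (i, max N m)"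
    have j: "N \<le> j" "m \<le> j" using le_prod_encode_2[of "max N m" i] by (auto simp: j_def)
    show "\<exists>k\<ge>N. s k = x \<and> (\<forall>i\<in>{1..m}. s (k + i) = 0)"
    proof (intro exI[of _ "j\<^sup>2"] conjI ballI)
      show "N \<le> j\<^sup>2" using j(1) power2_nat_le_imp_le le_trans by (metis le_square power2_eq_square)
      show "s (j\<^sup>2) = x" using i by (auto simp: s_def u_def j_def)
      fix i assume i: "i \<in> {1..m}"
      \<comment> \<open>The next square is \<open>j\<^sup>2 + 2 * j + 1\<close>, which lies beyond
        \<open>j\<^sup>2 + i\<close> because \<open>i \<le> m \<le> j\<close>.\<close>
      have "j\<^sup>2 + i \<noteq> l\<^sup>2" for l
      proof
        assume l: "j\<^sup>2 + i = l\<^sup>2"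
        then have "j\<^sup>2 < l\<^sup>2" using i by simp
        then have "Suc j \<le> l" by (metis Suc_leI power2_less_imp_less zero_le)
        then have "(Suc j)\<^sup>2 \<le> l\<^sup>2" by (rule power_mono) simp
        then show False using l i j by (simp add: power2_eq_square)
      qed
      then show "s (j\<^sup>2 + i) = 0" by (simp add: s_def)
    qed
  qed
qed

text \<open>A right inverse exists by linear algebra alone, without any bound on its norm. Its
  component along \<open>e\<close> lies in the kernel of \<open>A\<close> and can be
  subtracted.\<close>

lemma linear_right_inverse_orthogonal:
  fixes A :: "'a::complex_inner \<Rightarrow> 'a"
  assumes A: "bounded_clinear A" and surj: "surj A" and e: "A e = 0" "e \<noteq> 0"
  obtains R where "\<And>y. A (R y) = y" "\<And>x y. R (x + y) = R x + R y"
    "\<And>c x. R (c *\<^sub>C x) = c *\<^sub>C R x" "\<And>x. cinner (R x) e = 0"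
proof -
  interpret P: vector_space_pair "scaleC :: complex \<Rightarrow> 'a \<Rightarrow> 'a" "scaleC :: complex \<Rightarrow> 'a \<Rightarrow> 'a" ..
  have "Vector_Spaces.linear scaleC scaleC A" using A by (simp add: bounded_clinear_def)
  from P.linear_surjective_right_inverse[OF this surj]
  obtain R0 where R0: "Vector_Spaces.linear scaleC scaleC R0" "A \<circ> R0 = id" by blast
  have A': "A (x - y) = A x - A y" "A (c *\<^sub>C x) = c *\<^sub>C A x" for x y c
    using A by (auto simp: bounded_clinear_iff linear_diff bounded_linear.linear)
  have R0': "R0 (x + y) = R0 x + R0 y" "R0 (c *\<^sub>C x) = c *\<^sub>C R0 x" "A (R0 x) = x" for x y c
    using R0 by (auto simp: Vector_Spaces.linear_iff fun_eq_iff)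
  have ee: "cinner e e \<noteq> 0" using e by (metis inner_eq_Re_cinner inner_eq_zero_iff zero_complex.sel(1))
  define q where "q x = cinner (R0 x) e / cinner e e" for x
  show thesis
  proof (rule that[of "\<lambda>x. R0 x - q x *\<^sub>C e"])
    show "A (R0 y - q y *\<^sub>C e) = y" for y by (simp add: A' R0' e)
    show "R0 (x + y) - q (x + y) *\<^sub>C e = (R0 x - q x *\<^sub>C e) + (R0 y - q y *\<^sub>C e)" for x y
      by (simp add: R0' q_def cinner_add_left add_divide_distrib complex_vector.scale_left_distrib)
    show "R0 (c *\<^sub>C x) - q (c *\<^sub>C x) *\<^sub>C e = c *\<^sub>C (R0 x - q x *\<^sub>C e)" for c x
      by (simp add: R0' q_def cinner_scaleC_left complex_vector.scale_right_diff_distrib scaleC_scaleC)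
    show "cinner (R0 x - q x *\<^sub>C e) e = 0" for x
      using ee linear_diff[OF bounded_linear.linear[OF bounded_linear_cinner_left[of e]]]
      by (simp add: cinner_scaleC_left q_def)
  qed
qed

text \<open>The sequence is obtained from \<open>f 0 = e\<close> by \<open>f (k + 1) = R (f k) + c k *\<^sub>R s k\<close>, where \<open>R\<close> is a
  right inverse of \<open>A\<close> and the \<open>s k\<close> lie in the kernel, \<open>R (f k)\<close> and \<open>s k\<close> being orthogonal
  to \<open>e\<close>. The scalars \<open>c k\<close> grow so fast that after a jump \<open>s k = b\<close> followed by many zeros,
  \<open>f (k + 1 + m) / c k\<close> is close to \<open>(R ^^ m) b\<close>.\<close>

lemma backward_shift_sequence_exists:
  fixes A :: "'a::complex_inner \<Rightarrow> 'a"
  assumes A: "bounded_clinear A" and surj: "surj A" and dense: "closure (root_space A) = UNIV"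
    and B: "countable B" "B \<subseteq> op_kernel A" "op_kernel A \<subseteq> cspan B"
    and e: "e \<in> op_kernel A" "e \<noteq> 0"
  obtains f where "complete_seq f" "minimal_seq f" "backward_shift_on A f"
proof -
  have Ae: "A e = 0" using e by (simp add: op_kernel_def)
  obtain R where R: "\<And>y. A (R y) = y" "\<And>x y. R (x + y) = R x + R y"
    "\<And>c x. R (c *\<^sub>C x) = c *\<^sub>C R x" "\<And>x. cinner (R x) e = 0"
    using linear_right_inverse_orthogonal[OF A surj Ae e(2)] by metis
  have R0: "R 0 = 0" using R(2)[of 0 0] by simp
  have Rpow: "(R ^^ m) 0 = 0" "(R ^^ m) (x + y) = (R ^^ m) x + (R ^^ m) y"
    "(R ^^ m) (c *\<^sub>C x) = c *\<^sub>C (R ^^ m) x" for m x y c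
    by (induction m) (auto simp: R0 R)
  have A': "A (x + y) = A x + A y" "A (x - y) = A x - A y" "A (c *\<^sub>C x) = c *\<^sub>C A x" "A 0 = 0" for x y c
    using A by (auto simp: bounded_clinear_iff linear_diff linear_add linear_0 bounded_linear.linear)
  have ci: "cinner (x - y) e = cinner x e - cinner y e" "cinner 0 e = 0" for x y
    using linear_diff[OF bounded_linear.linear[OF bounded_linear_cinner_left[of e]]]
      linear_0[OF bounded_linear.linear[OF bounded_linear_cinner_left[of e]]] by simp_all
  have ee: "cinner e e \<noteq> 0" using e by (metis inner_eq_Re_cinner inner_eq_zero_iff zero_complex.sel(1))

  \<comment> \<open>Removing the projection onto \<open>e\<close> keeps the vectors to be added
    orthogonal to \<open>e\<close>, as minimality demands, while \<open>e\<close> and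
    \<open>B'\<close> together still span the kernel.\<close>
  define q where "q b = cinner b e / cinner e e" for b
  define B' where "B' = (\<lambda>b. b - q b *\<^sub>C e) ` B"
  have kerB': "op_kernel A \<subseteq> cspan (insert e B')"
  proof -
    have "b \<in> cspan (insert e B')" if "b \<in> B" for b
    proof -
      have 1: "b - q b *\<^sub>C e \<in> cspan (insert e B')"
        using that unfolding B'_def by (intro complex_vector.span_base) blast
      have 2: "q b *\<^sub>C e \<in> cspan (insert e B')"
        by (intro complex_vector.span_scale complex_vector.span_base) blast
      show ?thesis using complex_vector.span_add[OF 1 2] by simp
    qed
    then have "cspan B \<subseteq> cspan (insert e B')"
      by (intro complex_vector.span_minimal complex_vector.subspace_span) auto
    then show ?thesis using B by blast
  qed
  have "countable B'" using B by (simp add: B'_def)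
  then obtain s :: "nat \<Rightarrow> 'a" where s: "range s \<subseteq> insert 0 B'"
    and s_sparse: "\<And>x m N. x \<in> B' \<Longrightarrow> \<exists>k\<ge>N. s k = x \<and> (\<forall>i\<in>{1..m}. s (k + i) = 0)"
    using sparse_enumeration by metis
  have B'e: "cinner b e = 0" "A b = 0" if "b \<in> B'" for b
    using that B ee Ae by (auto simp: B'_def q_def ci cinner_scaleC_left A' op_kernel_def)
  have se: "cinner (s k) e = 0" "A (s k) = 0" for k
    using s B'e ci A'(4) by (metis insert_iff range_subsetD)+

  \<comment> \<open>Dividing by \<open>c k x\<close> brings all \<open>(R ^^ Suc m) x\<close> with
    \<open>m \<le> k\<close> below \<open>1 / k\<close> at once for \<open>k > 0\<close>, even if
    \<open>R\<close> is unbounded; the summand 1 keeps the scalar positive.\<close>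
  define c where "c k x = real k * (\<Sum>m\<le>k. norm ((R ^^ Suc m) x)) + 1" for k x
  have c_pos: "c k x > 0" for k x by (simp add: c_def add_nonneg_pos sum_nonneg)
  define f where "f = rec_nat e (\<lambda>k x. R x + complex_of_real (c k x) *\<^sub>C s k)"
  have f0: "f 0 = e" and fSuc: "f (Suc k) = R (f k) + complex_of_real (c k (f k)) *\<^sub>C s k" for k
    by (simp_all add: f_def)
  have shift: "backward_shift_on A f"
    unfolding backward_shift_on_def
  proof (intro conjI allI impI A)
    show "A (f 0) = 0" by (simp add: f0 Ae)
    fix k :: nat assume "k \<ge> 1"
    then obtain l where "k = Suc l" by (cases k) auto
    then show "A (f k) = f (k - 1)" by (simp add: fSuc A' R se)
  qed
  have "cinner (f k) e = 0" if "k > 0" for k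
    using that by (cases k) (auto simp: fSuc cinner_add_left cinner_scaleC_left R se)
  then have minimal: "minimal_seq f"
    using minimal_seq_backward_shift[OF shift] ee f0 by metis

  \<comment> \<open>This is the smallest \<open>R\<close>-invariant subspace containing
    \<open>S\<close>.\<close>
  define W where "W S = cspan (\<Union>m. (R ^^ m) ` S)" for S
  have W_base: "(R ^^ m) b \<in> W S" if "b \<in> S" for m b S
    using that unfolding W_def by (intro complex_vector.span_base) blast
  have W_sub: "csubspace (W S)" for S by (simp add: W_def)
  have W_R: "R x \<in> W S" if "x \<in> W S" for x S
  proof -
    have "W S \<subseteq> {x. R x \<in> W S}"
      unfolding W_def[of S]
    proof (rule complex_vector.span_minimal)
      show "csubspace {x. R x \<in> cspan (\<Union>m. (R ^^ m) ` S)}"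
        by (intro complex_vector.subspaceI)
          (auto simp: R R0 complex_vector.span_zero intro: complex_vector.span_add complex_vector.span_scale)
      show "(\<Union>m. (R ^^ m) ` S) \<subseteq> {x. R x \<in> cspan (\<Union>m. (R ^^ m) ` S)}"
        using W_base[of _ S "Suc _"] by (auto simp: W_def)
    qed
    then show ?thesis using that by blast
  qed
  let ?V = "closed_cspan (range f)"
  note V = csubspace_closed_cspan[of "range f"]
  \<comment> \<open>As long as \<open>s\<close> vanishes, the recursion merely applies
    \<open>R\<close> to both summands produced by the jump.\<close>
  have block: "f (Suc k + m) = (R ^^ Suc m) (f k) + complex_of_real (c k (f k)) *\<^sub>C (R ^^ m) (s k)"
    if "\<forall>i\<in>{1..m}. s (k + i) = 0" for k m
    using that
  proof (induction m)
    case 0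
    then show ?case by (simp add: fSuc)
  next
    case (Suc m)
    then have "f (Suc k + m) = (R ^^ Suc m) (f k) + complex_of_real (c k (f k)) *\<^sub>C (R ^^ m) (s k)" by simp
    moreover have "s (Suc k + m) = 0" using Suc.prems by (auto dest: bspec[of _ _ "Suc m"])
    ultimately show ?case using fSuc[of "Suc k + m"] by (simp add: R)
  qed
  have V_B': "(R ^^ m) b \<in> ?V" if b: "b \<in> B'" for m b
    unfolding closed_cspan_def closure_approachable
  proof (intro allI impI)
    fix \<epsilon> :: real assume "\<epsilon> > 0"
    then obtain N :: nat where N: "1 / \<epsilon> < real N" using reals_Archimedean2 by blast
    \<comment> \<open>\<open>k \<ge> m\<close> puts the term for \<open>m\<close> into the sum
      defining \<open>c\<close>, and \<open>k \<ge> N\<close> makes \<open>1 / k\<close> smaller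
      than \<open>\<epsilon>\<close>.\<close>
    obtain k where k: "k \<ge> max N m" "s k = b" "\<forall>i\<in>{1..m}. s (k + i) = 0"
      using s_sparse[OF b] by metis
    let ?c = "c k (f k)"
    let ?y = "complex_of_real (1 / ?c) *\<^sub>C f (Suc k + m)"
    have "?y - (R ^^ m) b = complex_of_real (1 / ?c) *\<^sub>C (R ^^ Suc m) (f k)"
      using c_pos[of k "f k"] unfolding block[OF k(3)] k(2)
      by (simp add: scaleC_add_right scaleC_scaleC scaleC_one del: funpow.simps flip: of_real_mult)
    then have dist: "dist ?y ((R ^^ m) b) = norm ((R ^^ Suc m) (f k)) / ?c"
      using c_pos[of k "f k"] by (simp add: dist_norm norm_scaleC norm_divide del: funpow.simps)
    have "1 / \<epsilon> < real k" using N k(1) by linarith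
    moreover have "1 / \<epsilon> > 0" using \<open>\<epsilon> > 0\<close> by simp
    ultimately have kpos: "1 / \<epsilon> < real k" "real k > 0" by linarith+
    have "norm ((R ^^ Suc m) (f k)) \<le> (\<Sum>m\<le>k. norm ((R ^^ Suc m) (f k)))"
      using k by (intro member_le_sum) auto
    then have "real k * norm ((R ^^ Suc m) (f k)) < ?c"
      using mult_left_mono[OF _ of_nat_0_le_iff[of k]] by (fastforce simp: c_def simp del: funpow.simps)
    then have "norm ((R ^^ Suc m) (f k)) / ?c < 1 / real k"
      using c_pos[of k "f k"] kpos by (simp add: field_simps del: funpow.simps)
    also have "\<dots> < \<epsilon>" using kpos \<open>\<epsilon> > 0\<close> by (simp add: field_simps)
    finally have "dist ?y ((R ^^ m) b) < \<epsilon>" unfolding dist .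
    moreover have "?y \<in> cspan (range f)"
      by (intro complex_vector.span_scale complex_vector.span_base) blast
    ultimately show "\<exists>y\<in>cspan (range f). dist y ((R ^^ m) b) < \<epsilon>" by blast
  qed
  then have "(\<Union>m. (R ^^ m) ` B') \<subseteq> ?V" by blast
  then have W_V: "W B' \<subseteq> ?V" unfolding W_def by (rule complex_vector.span_minimal[OF _ V])
  \<comment> \<open>All jumps and their images under \<open>R\<close> lie in \<open>W B'\<close>, so
    modulo this subspace of \<open>?V\<close> the vector \<open>f m\<close> equals
    \<open>(R ^^ m) e\<close>.\<close>
  have V_e: "(R ^^ m) e \<in> ?V" for m
  proof -
    have "f m - (R ^^ m) e \<in> W B'"
    proof (induction m)
      case 0
      then show ?case using complex_vector.subspace_0[OF W_sub] by (simp add: f0)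
    next
      case (Suc m)
      have "s m \<in> W B'"
        using s W_base[of _ B' 0] complex_vector.subspace_0[OF W_sub] by (force dest: range_subsetD[of s _ m])
      moreover have "R (f m) = R (f m - (R ^^ m) e) + (R ^^ Suc m) e" using R(2)[of "f m - (R ^^ m) e" "(R ^^ m) e"] by simp
      then have "f (Suc m) - (R ^^ Suc m) e
          = R (f m - (R ^^ m) e) + complex_of_real (c m (f m)) *\<^sub>C s m" by (simp add: fSuc)
      ultimately show ?case
        using W_R[OF Suc] W_sub complex_vector.subspace_add complex_vector.subspace_scale by metis
    qed
    then have "f m - (R ^^ m) e \<in> ?V" using W_V by blast
    from complex_vector.subspace_diff[OF V closed_cspan_base this]
    have "f m - (f m - (R ^^ m) e) \<in> ?V" by blast
    then show ?thesis by simp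
  qed
  have W_V': "W (insert e B') \<subseteq> ?V"
    unfolding W_def by (rule complex_vector.span_minimal[OF _ V]) (use V_e V_B' in auto)
  have ker_W: "op_kernel A \<subseteq> W (insert e B')"
    using kerB' complex_vector.span_minimal[OF _ W_sub, of "insert e B'" "insert e B'"]
      W_base[of _ "insert e B'" 0] by (metis funpow_0 order_trans subsetI)
  \<comment> \<open>Split \<open>x\<close> into \<open>R (A x)\<close>, covered by the induction and
    the invariance of \<open>W\<close>, and \<open>x - R (A x)\<close>, which \<open>A\<close>
    kills.\<close>
  have "x \<in> W (insert e B')" if "(A ^^ k) x = 0" for k x
    using that
  proof (induction k arbitrary: x)
    case 0
    then show ?case using complex_vector.subspace_0[OF W_sub] by simp
  next
    case (Suc k)
    then have "R (A x) \<in> W (insert e B')" by (intro W_R Suc.IH) (simp add: funpow_Suc_right del: funpow.simps)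
    moreover have "x - R (A x) \<in> W (insert e B')"
      using ker_W by (auto simp: op_kernel_def A' R)
    ultimately show ?case using complex_vector.subspace_add[OF W_sub] by fastforce
  qed
  then have "root_space A \<subseteq> ?V" using W_V' by (auto simp: root_space_def)
  then have "closure (root_space A) \<subseteq> ?V" by (rule closure_minimal) (simp add: closed_cspan_def)
  then have "complete_seq f" using dense by (auto simp: complete_seq_def)
  then show thesis using minimal shift by (rule that)
qed

section \<open>Application to Cowen-Douglas operators\<close>

theorem theorem1p1:
  fixes T :: "'a::chilbert_space \<Rightarrow> 'a"
    and \<Omega> :: "complex set"
    and n :: nat
  assumes "separable_space (euclidean :: 'a topology)"
    and "cinfinite_dimensional TYPE('a)"
    and "n > 0"
    and "open \<Omega>" and "connected \<Omega>"
    and "T \<in> cowen_douglas n \<Omega>"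
  shows "\<forall>z\<^sub>0\<in>\<Omega>. \<exists>f :: nat \<Rightarrow> 'a.
    complete_seq f \<and> minimal_seq f \<and> backward_shift_on (op_shift T z\<^sub>0) f"
proof
  fix z\<^sub>0 assume z: "z\<^sub>0 \<in> \<Omega>"
  let ?A = "op_shift T z\<^sub>0"
  have T: "bounded_clinear T" and surj: "\<And>z. z \<in> \<Omega> \<Longrightarrow> surj (op_shift T z)"
    and dense: "closed_cspan (\<Union>z\<in>\<Omega>. op_kernel (op_shift T z)) = UNIV"
    and dim: "cdim (op_kernel ?A) = n"
    using assms(6) z by (auto simp: cowen_douglas_def)
  obtain B where B: "B \<subseteq> op_kernel ?A" "\<not> cdependent B" "op_kernel ?A \<subseteq> cspan B" "card B = n"
    using complex_vector.basis_exists[of "op_kernel ?A"] dim by metis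
  \<comment> \<open>Infinite sets have \<open>card\<close> 0, so \<open>n > 0\<close> gives
    finiteness as well as a basis vector \<open>e\<close> to start from.\<close>
  have "finite B" "B \<noteq> {}" using B(4) \<open>n > 0\<close> by (auto intro: card_ge_0_finite)
  then obtain e where "e \<in> B" by blast
  moreover from this have "e \<noteq> 0" using B(2) complex_vector.dependent_zero by metis
  ultimately show "\<exists>f. complete_seq f \<and> minimal_seq f \<and> backward_shift_on ?A f"
    using backward_shift_sequence_exists[OF bounded_clinear_op_shift[OF T] surj[OF z]
        closure_root_space_eq_UNIV[OF T assms(4,5) surj dense z] countable_finite B(1,3)]
      \<open>finite B\<close> B(1) by (metis subsetD)
qed

end
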